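(* Let $\mathcal{H}\cong\mathbb{C}^n$ and let $\mathbf{a},\mathbf{b}$ be self-adjoint operators on $\mathcal{H}$ with $\mathrm{Tr}(\mathbf{a})=\mathrm{Tr}(\mathbf{b})=0$. Then the integral curve of the vector field $Y_{\mathbf{a}}+X_{\mathbf{b}}$ on $\mathfrak{T}_1$ starting at a quantum state $\rho\in\mathcal{S}$ is given by $$\gamma_t(\rho)=\frac{\mathbf{g}_t\,\rho\,\mathbf{g}_t^\dagger}{\mathrm{Tr}(\mathbf{g}_t\,\rho\,\mathbf{g}_t^\dagger)},$$ where $\mathbf{A}=\mathbf{a}+i\mathbf{b}\in\mathfrak{sl}(\mathcal{H},\mathbb{C})$, so that $\mathbf{g}_t=\exp\left(\tfrac t2\mathbf{A}\right)$ is in $SL(\mathcal{H},\mathbb{C})$ for all $t$.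
   Context: $\mathfrak{O}$ is the real vector space of self-adjoint operators on $\mathcal{H}\cong\mathbb{C}^n$, and its dual $\mathfrak{O}^*$ is identified with self-adjoint $n\times n$ matrices through $\xi(\mathbf{a})=\mathrm{Tr}(\xi\mathbf{a})$. Products: $\mathbf{a}\odot\mathbf{b}=\frac12(\mathbf{ab}+\mathbf{ba})$ and $[[\mathbf{a},\mathbf{b}]]=\frac{i}{2}(\mathbf{ab}-\mathbf{ba})$. $\mathfrak{T}_1=\{\xi\in\mathfrak{O}^*:\mathrm{Tr}\,\xi=1\}$ is an affine space, regarded as a smooth manifold, and $\mathcal{S}\subset\mathfrak{T}_1$ is the set of quantum states (positive semidefinite matrices of trace $1$). For $\mathbf{a}\in\mathfrak{O}$, $f_{\mathbf{a}}(\xi)=\mathrm{Tr}(\xi\mathbf{a})$ is the associated affine function on $\mathfrak{T}_1$. The differentials of these functions span each cotangent space of $\mathfrak{T}_1$, so a vector field on $\mathfrak{T}_1$ is determined by its action on them. The gradient-like vector field $Y_{\mathbf{a}}$ and the Hamiltonian vector field $X_{\mathbf{b}}$ on $\mathfrak{T}_1$ are determined by $$Y_{\mathbf{a}}(f_{\mathbf{c}})=f_{\mathbf{a}\odot\mathbf{c}}-f_{\mathbf{a}}f_{\mathbf{c}},\qquad X_{\mathbf{b}}(f_{\mathbf{c}})=f_{[[\mathbf{b},\mathbf{c}]]}\qquad\text{for all }\mathbf{c}\in\mathfrak{O}.$$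
   Formalization: The formal theorem takes A = a − ib instead of A = a + ib: with the stated definition of X_b one gets X_b(ξ) = (i/2)(ξb − bξ), so the printed sign fails (e.g. a = 0, b = diag(1,−1), ρ with all entries 1/2). *)

theory Defs
  imports "HOL-Analysis.Analysis"
begin

text \<open>
  The Hilbert space is \<open>complex^'n\<close> with the standard inner product, of dimension \<open>n = CARD('n)\<close>,
  and operators are identified with their matrices in the standard basis.
  Matrix multiplication is \<open>**\<close>; the type-class multiplication of the type \<open>complex^'n^'n\<close> is
  componentwise and must not be used here (nor its powers).
\<close>

definition cscale :: "complex \<Rightarrow> complex^'n^'m \<Rightarrow> complex^'n^'m"  (infixr \<open>\<cdot>\<^sub>C\<close> 75)
  where "c \<cdot>\<^sub>C M = map_matrix (\<lambda>z. c * z) M"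

definition dagger :: "complex^'n^'m \<Rightarrow> complex^'m^'n"  (\<open>_\<^sup>\<dagger>\<close> [1000] 1000)
  where "M\<^sup>\<dagger> = transpose (map_matrix cnj M)"

definition selfadjoint_ops :: "(complex^'n^'n) set"  (\<open>\<OO>\<close>)
  where "\<OO> = {a. a\<^sup>\<dagger> = a}"

definition jordan_prod :: "complex^'n^'n \<Rightarrow> complex^'n^'n \<Rightarrow> complex^'n^'n"  (infixl \<open>\<odot>\<close> 70)
  where "a \<odot> b = (1/2) \<cdot>\<^sub>C (a ** b + b ** a)"

definition lie_prod :: "complex^'n^'n \<Rightarrow> complex^'n^'n \<Rightarrow> complex^'n^'n"  (\<open>\<lbrakk>_, _\<rbrakk>\<^sub>L\<close>)
  where "\<lbrakk>a, b\<rbrakk>\<^sub>L = (\<i>/2) \<cdot>\<^sub>C (a ** b - b ** a)"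

definition trace_one_space :: "(complex^'n^'n) set"  (\<open>\<TT>\<^sub>1\<close>)
  where "\<TT>\<^sub>1 = {\<xi> \<in> \<OO>. trace \<xi> = 1}"

definition quantum_states :: "(complex^'n^'n) set"  (\<open>\<S>\<close>)
  where "\<S> = {\<xi> \<in> \<TT>\<^sub>1. \<forall>v. 0 \<le> Re (\<Sum>i\<in>UNIV. cnj (v $ i) * (\<xi> *v v) $ i)}"

text \<open>For \<open>\<xi>, a \<in> \<OO>\<close> the trace below is real, see \<open>affine_fun_trace\<close>.\<close>

definition affine_fun :: "complex^'n^'n \<Rightarrow> complex^'n^'n \<Rightarrow> real"
  where "affine_fun a \<xi> = Re (trace (\<xi> ** a))"

text \<open>
  The tangent space of the affine space \<open>\<TT>\<^sub>1\<close> at each of its points is its space of translations.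
  A tangent vector \<open>v\<close> at \<open>\<xi>\<close> acts on functions by differentiation along the line
  \<open>\<xi> + s v\<close>, which lies in \<open>\<TT>\<^sub>1\<close>.
\<close>

definition tangent_space :: "(complex^'n^'n) set"
  where "tangent_space = {v \<in> \<OO>. trace v = 0}"

definition tangent_action :: "complex^'n^'n \<Rightarrow> complex^'n^'n \<Rightarrow> (complex^'n^'n \<Rightarrow> real) \<Rightarrow> real"
  where "tangent_action \<xi> v f = vector_derivative (\<lambda>s. f (\<xi> + s *\<^sub>R v)) (at 0)"

text \<open>
  The two vector fields are given by their action on the functions \<open>affine_fun c\<close>.
  Unique existence on \<open>\<TT>\<^sub>1\<close> and explicit formulas are proved below; the values outside \<open>\<TT>\<^sub>1\<close>
  have no meaning.
\<close>

definition gradient_vf :: "complex^'n^'n \<Rightarrow> complex^'n^'n \<Rightarrow> complex^'n^'n"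
  where "gradient_vf a \<xi> = (THE v. v \<in> tangent_space \<and> (\<forall>c\<in>\<OO>.
    tangent_action \<xi> v (affine_fun c) = affine_fun (a \<odot> c) \<xi> - affine_fun a \<xi> * affine_fun c \<xi>))"

definition hamiltonian_vf :: "complex^'n^'n \<Rightarrow> complex^'n^'n \<Rightarrow> complex^'n^'n"
  where "hamiltonian_vf b \<xi> = (THE v. v \<in> tangent_space \<and> (\<forall>c\<in>\<OO>.
    tangent_action \<xi> v (affine_fun c) = affine_fun \<lbrakk>b, c\<rbrakk>\<^sub>L \<xi>))"

definition integral_curve ::
    "(complex^'n^'n \<Rightarrow> complex^'n^'n) \<Rightarrow> real set \<Rightarrow> (real \<Rightarrow> complex^'n^'n) \<Rightarrow> bool"
  where "integral_curve V J \<gamma> \<longleftrightarrow> open J \<and> connected J \<and>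
    (\<forall>t\<in>J. \<gamma> t \<in> \<TT>\<^sub>1 \<and> (\<gamma> has_vector_derivative V (\<gamma> t)) (at t))"

definition matrix_exp :: "complex^'n^'n \<Rightarrow> complex^'n^'n"
  where "matrix_exp M = (\<Sum>k. (1 / fact k) *\<^sub>R (((**) M) ^^ k) (mat 1))"

definition sl_alg :: "(complex^'n^'n) set"
  where "sl_alg = {M. trace M = 0}"

definition SL_grp :: "(complex^'n^'n) set"
  where "SL_grp = {M. det M = 1}"


subsection \<open>The vector fields are well defined\<close>

lemma cscale_nth [simp]: "(c \<cdot>\<^sub>C M) $ i $ j = c * M $ i $ j"
  by (simp add: cscale_def)

lemma dagger_nth [simp]: "M\<^sup>\<dagger> $ i $ j = cnj (M $ j $ i)"
  by (simp add: dagger_def transpose_def)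

lemma selfadjoint_nth: "a \<in> \<OO> \<longleftrightarrow> (\<forall>i j. cnj (a $ j $ i) = a $ i $ j)"
  by (simp add: selfadjoint_ops_def vec_eq_iff)

lemma dagger_mult: "(M ** N)\<^sup>\<dagger> = N\<^sup>\<dagger> ** M\<^sup>\<dagger>"
  by (simp add: vec_eq_iff matrix_matrix_mult_def mult.commute)

lemma dagger_add: "(M + N)\<^sup>\<dagger> = M\<^sup>\<dagger> + N\<^sup>\<dagger>"
  by (simp add: vec_eq_iff)

lemma dagger_diff: "(M - N)\<^sup>\<dagger> = M\<^sup>\<dagger> - N\<^sup>\<dagger>"
  by (simp add: vec_eq_iff)

lemma dagger_cscale: "(c \<cdot>\<^sub>C M)\<^sup>\<dagger> = cnj c \<cdot>\<^sub>C M\<^sup>\<dagger>"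
  by (simp add: vec_eq_iff)

lemma dagger_scaleR: "(r *\<^sub>R M)\<^sup>\<dagger> = r *\<^sub>R M\<^sup>\<dagger>"
  by (simp add: vec_eq_iff)

lemma trace_cscale: "trace (c \<cdot>\<^sub>C M) = c * trace M"
  by (simp add: trace_def sum_distrib_left)

lemma trace_scaleR_complex: "trace (r *\<^sub>R M) = r *\<^sub>R trace (M :: complex^'n^'n)"
  by (simp add: trace_def scaleR_sum_right)

lemma trace_dagger: "trace (M\<^sup>\<dagger>) = cnj (trace M)"
  by (simp add: trace_def)

lemma cscale_mult_left: "(c \<cdot>\<^sub>C M) ** N = c \<cdot>\<^sub>C (M ** N)"
  by (simp add: vec_eq_iff matrix_matrix_mult_def sum_distrib_left mult.assoc)

lemma cscale_mult_right: "M ** (c \<cdot>\<^sub>C N) = c \<cdot>\<^sub>C (M ** N)"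
  by (simp add: vec_eq_iff matrix_matrix_mult_def sum_distrib_left mult.left_commute)

lemma mult_add_left: "((M :: complex^'n^'n) + M') ** N = M ** N + M' ** N"
  by (simp add: vec_eq_iff matrix_matrix_mult_def sum.distrib distrib_right)

lemma mult_diff_left: "((M :: complex^'n^'n) - M') ** N = M ** N - M' ** N"
  by (simp add: vec_eq_iff matrix_matrix_mult_def sum_subtractf left_diff_distrib)

lemma mult_diff_right: "(M :: complex^'n^'n) ** (N - N') = M ** N - M ** N'"
  by (simp add: vec_eq_iff matrix_matrix_mult_def sum_subtractf right_diff_distrib)

lemma scaleR_mult_left: "(r *\<^sub>R (M :: complex^'n^'n)) ** N = r *\<^sub>R (M ** N)"
  by (simp add: vec_eq_iff matrix_matrix_mult_def scaleR_sum_right)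

lemma affine_fun_trace:
  assumes "\<xi> \<in> \<OO>" "a \<in> \<OO>"
  shows "of_real (affine_fun a \<xi>) = trace (\<xi> ** a)"
proof -
  have "cnj (trace (\<xi> ** a)) = trace ((\<xi> ** a)\<^sup>\<dagger>)"
    by (simp add: trace_dagger)
  also have "\<dots> = trace (\<xi> ** a)"
    using assms by (simp add: dagger_mult selfadjoint_ops_def trace_mul_sym[of a])
  finally have "trace (\<xi> ** a) \<in> \<real>"
    by (simp only: Reals_cnj_iff)
  then show ?thesis
    by (simp add: affine_fun_def)
qed

lemma tangent_action_affine_fun: "tangent_action \<xi> v (affine_fun c) = Re (trace (v ** c))"
proof -
  have "(\<lambda>s. affine_fun c (\<xi> + s *\<^sub>R v))
      = (\<lambda>s. Re (trace (\<xi> ** c)) + s *\<^sub>R Re (trace (v ** c)))"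
    by (simp add: affine_fun_def mult_add_left scaleR_mult_left trace_add
        trace_scaleR_complex)
  moreover have "((\<lambda>s. Re (trace (\<xi> ** c)) + s *\<^sub>R Re (trace (v ** c)))
      has_vector_derivative Re (trace (v ** c))) (at 0)"
    by (auto intro!: derivative_eq_intros)
  ultimately show ?thesis
    unfolding tangent_action_def by (simp only: vector_derivative_at)
qed

lemma selfadjoint_trace_sq_eq_0:
  assumes "d \<in> \<OO>" "Re (trace (d ** d)) = 0"
  shows "d = 0"
proof -
  have "Re (d $ i $ j * d $ j $ i) = (cmod (d $ i $ j))\<^sup>2" for i j
    using assms(1)[unfolded selfadjoint_nth, rule_format, of i j]
    by (metis Re_complex_of_real complex_norm_square)
  then have "(\<Sum>i\<in>UNIV. \<Sum>j\<in>UNIV. (cmod (d $ i $ j))\<^sup>2) = 0"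
    using assms(2) by (simp add: trace_def matrix_matrix_mult_def)
  then show ?thesis
    by (simp add: sum_nonneg_eq_0_iff sum_nonneg vec_eq_iff)
qed

lemma tangent_vector_eqI:
  assumes "v \<in> tangent_space" "w \<in> tangent_space"
    and "\<And>c. c \<in> \<OO> \<Longrightarrow>
      tangent_action \<xi> v (affine_fun c) = tangent_action \<xi> w (affine_fun c)"
  shows "v = w"
proof -
  have sa: "v - w \<in> \<OO>"
    using assms(1,2) by (simp add: tangent_space_def selfadjoint_ops_def dagger_diff)
  from assms(3)[OF sa] have "Re (trace ((v - w) ** (v - w))) = 0"
    by (simp add: tangent_action_affine_fun mult_diff_left trace_sub)
  from selfadjoint_trace_sq_eq_0[OF sa this] show ?thesis by simp
qed

lemma gradient_vf_eq:
  assumes "a \<in> \<OO>" "\<xi> \<in> \<TT>\<^sub>1"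
  shows "gradient_vf a \<xi> = a \<odot> \<xi> - affine_fun a \<xi> *\<^sub>R \<xi>" (is "_ = ?w")
    and "gradient_vf a \<xi> \<in> tangent_space"
    and "\<And>c. c \<in> \<OO> \<Longrightarrow> tangent_action \<xi> (gradient_vf a \<xi>) (affine_fun c)
      = affine_fun (a \<odot> c) \<xi> - affine_fun a \<xi> * affine_fun c \<xi>"
proof -
  have \<xi>: "\<xi> \<in> \<OO>" "trace \<xi> = 1"
    using assms(2) by (auto simp: trace_one_space_def)
  have "trace (a \<odot> \<xi>) = of_real (affine_fun a \<xi>)"
    using affine_fun_trace[OF \<xi>(1) assms(1)]
    by (simp add: jordan_prod_def trace_cscale trace_add trace_mul_sym[of a \<xi>])
  moreover have "(a \<odot> \<xi>)\<^sup>\<dagger> = a \<odot> \<xi>"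
    using \<xi>(1) assms(1)
    by (simp add: jordan_prod_def dagger_cscale dagger_add dagger_mult selfadjoint_ops_def add.commute)
  ultimately have w: "?w \<in> tangent_space"
    using \<xi> by (simp add: tangent_space_def selfadjoint_ops_def dagger_diff dagger_scaleR trace_sub
        trace_scaleR_complex scaleR_conv_of_real[where 'a=complex])
  have act: "tangent_action \<xi> ?w (affine_fun c)
      = affine_fun (a \<odot> c) \<xi> - affine_fun a \<xi> * affine_fun c \<xi>" for c
  proof -
    have "trace (a ** \<xi> ** c) = trace (\<xi> ** (c ** a))"
      by (metis matrix_mul_assoc trace_mul_sym)
    then have "trace ((a \<odot> \<xi>) ** c) = trace (\<xi> ** (a \<odot> c))"
      by (simp add: jordan_prod_def cscale_mult_left cscale_mult_right trace_cscale
          mult_add_left matrix_add_ldistrib trace_add matrix_mul_assoc)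
    then show ?thesis
      by (simp add: tangent_action_affine_fun mult_diff_left trace_sub scaleR_mult_left
          trace_scaleR_complex) (simp add: affine_fun_def)
  qed
  show *: "gradient_vf a \<xi> = ?w"
    unfolding gradient_vf_def
  proof (rule the_equality)
    show "?w \<in> tangent_space \<and> (\<forall>c\<in>\<OO>. tangent_action \<xi> ?w (affine_fun c)
        = affine_fun (a \<odot> c) \<xi> - affine_fun a \<xi> * affine_fun c \<xi>)"
      using w act by blast
  qed (rule tangent_vector_eqI[OF _ w, where \<xi> = \<xi>], auto simp: act)
  show "gradient_vf a \<xi> \<in> tangent_space"
    using * w by simp
  show "tangent_action \<xi> (gradient_vf a \<xi>) (affine_fun c)
      = affine_fun (a \<odot> c) \<xi> - affine_fun a \<xi> * affine_fun c \<xi>" for c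
    using * act by simp
qed

text \<open>
  With these conventions the flow of \<open>hamiltonian_vf b\<close> is \<open>\<xi> \<mapsto> u \<xi> u\<^sup>\<dagger>\<close> with
  \<open>u = exp (- \<i> t b / 2)\<close>: for \<open>g = exp (t A / 2)\<close> with \<open>A = a - \<i> b\<close>, the derivative of
  \<open>g \<xi> g\<^sup>\<dagger>\<close> at \<open>t = 0\<close> is \<open>a \<odot> \<xi> + (\<i>/2) (\<xi> b - b \<xi>)\<close>, whereas \<open>A = a + \<i> b\<close> gives the
  opposite sign of the commutator.
\<close>

lemma hamiltonian_vf_eq:
  assumes "b \<in> \<OO>" "\<xi> \<in> \<TT>\<^sub>1"
  shows "hamiltonian_vf b \<xi> = (\<i>/2) \<cdot>\<^sub>C (\<xi> ** b - b ** \<xi>)" (is "_ = ?w")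
    and "hamiltonian_vf b \<xi> \<in> tangent_space"
    and "\<And>c. c \<in> \<OO> \<Longrightarrow>
      tangent_action \<xi> (hamiltonian_vf b \<xi>) (affine_fun c) = affine_fun \<lbrakk>b, c\<rbrakk>\<^sub>L \<xi>"
proof -
  have \<xi>: "\<xi> \<in> \<OO>"
    using assms(2) by (auto simp: trace_one_space_def)
  have "?w\<^sup>\<dagger> = (- (\<i>/2)) \<cdot>\<^sub>C (b ** \<xi> - \<xi> ** b)"
    using \<xi> assms(1) by (simp add: dagger_cscale dagger_diff dagger_mult selfadjoint_ops_def)
  also have "\<dots> = ?w"
    by (simp add: vec_eq_iff algebra_simps)
  finally have w: "?w \<in> tangent_space"
    by (simp add: tangent_space_def selfadjoint_ops_def trace_cscale trace_sub trace_mul_sym[of b])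
  have act: "tangent_action \<xi> ?w (affine_fun c) = affine_fun \<lbrakk>b, c\<rbrakk>\<^sub>L \<xi>" for c
  proof -
    have "trace (b ** \<xi> ** c) = trace (\<xi> ** (c ** b))"
      by (metis matrix_mul_assoc trace_mul_sym)
    then have "trace (?w ** c) = trace (\<xi> ** \<lbrakk>b, c\<rbrakk>\<^sub>L)"
      by (simp add: lie_prod_def cscale_mult_left cscale_mult_right trace_cscale
          mult_diff_left mult_diff_right trace_sub matrix_mul_assoc)
    then show ?thesis
      by (simp add: tangent_action_affine_fun affine_fun_def)
  qed
  show *: "hamiltonian_vf b \<xi> = ?w"
    unfolding hamiltonian_vf_def
  proof (rule the_equality)
    show "?w \<in> tangent_space \<and> (\<forall>c\<in>\<OO>. tangent_action \<xi> ?w (affine_fun c) = affine_fun \<lbrakk>b, c\<rbrakk>\<^sub>L \<xi>)"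
      using w act by blast
  qed (rule tangent_vector_eqI[OF _ w, where \<xi> = \<xi>], auto simp: act)
  show "hamiltonian_vf b \<xi> \<in> tangent_space"
    using * w by simp
  show "tangent_action \<xi> (hamiltonian_vf b \<xi>) (affine_fun c) = affine_fun \<lbrakk>b, c\<rbrakk>\<^sub>L \<xi>" for c
    using * act by simp
qed

end

theory Submission
  imports Defs
begin

text \<open>
  Put \<open>B = A/2\<close>. The unnormalised curve \<open>P t = g t ** \<rho> ** (g t)\<^sup>\<dagger>\<close> solves the linear equation
  \<open>P' = B P + P B\<^sup>\<dagger>\<close>, and on \<open>\<TT>\<^sub>1\<close> the vector field is \<open>L - Re (trace L) \<xi>\<close> with
  \<open>L = B \<xi> + \<xi> B\<^sup>\<dagger>\<close>, so dividing \<open>P\<close> by its trace gives an integral curve; the trace is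
  positive because \<open>\<rho>\<close> is a nonzero positive matrix and \<open>g t\<close> is invertible.
  For uniqueness, transport another integral curve \<open>\<eta>\<close> back to \<open>Q = g\<^sup>-\<^sup>1 \<eta> (g\<^sup>-\<^sup>1)\<^sup>\<dagger>\<close>. Then
  \<open>Q' = - affine_fun a \<eta> Q\<close>, so an integrating factor shows that \<open>Q\<close> remains a real multiple
  of \<open>\<rho>\<close>, and the multiple is fixed by \<open>trace \<eta> = 1\<close>.
\<close>

section \<open>Exponential series of a bounded linear map\<close>

lemma summable_exp_series:
  fixes T :: "'a::euclidean_space \<Rightarrow> 'a"
  assumes "bounded_linear T"
  shows "summable (\<lambda>k. (t ^ k / fact k) *\<^sub>R (T ^^ k) x)"
proof -
  obtain K where K: "K > 0" "\<And>y. norm (T y) \<le> norm y * K"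
    using bounded_linear.pos_bounded[OF assms] by blast
  have bound: "norm ((T ^^ k) x) \<le> K ^ k * norm x" for k
  proof (induction k)
    case (Suc k)
    have "norm ((T ^^ Suc k) x) \<le> norm ((T ^^ k) x) * K"
      using K(2) by simp
    also have "\<dots> \<le> (K ^ k * norm x) * K"
      using Suc K(1) by (intro mult_right_mono) auto
    finally show ?case by (simp add: mult_ac)
  qed simp
  have "summable (\<lambda>k. inverse (fact k) * (\<bar>t\<bar> * K) ^ k * norm x)"
    by (intro summable_mult2 summable_exp)
  then show ?thesis
  proof (rule summable_comparison_test')
    fix k
    have "norm ((t ^ k / fact k) *\<^sub>R (T ^^ k) x) = (\<bar>t\<bar> ^ k / fact k) * norm ((T ^^ k) x)"
      by (simp add: power_abs)
    also have "\<dots> \<le> (\<bar>t\<bar> ^ k / fact k) * (K ^ k * norm x)"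
      by (intro mult_left_mono bound) simp
    finally show "norm ((t ^ k / fact k) *\<^sub>R (T ^^ k) x)
        \<le> inverse (fact k) * (\<bar>t\<bar> * K) ^ k * norm x"
      by (simp add: field_simps power_mult_distrib)
  qed
qed

text \<open>Paired with a fixed vector, the series becomes an everywhere convergent real power
  series in \<open>t\<close>, which may be differentiated termwise; the components then give the
  vector derivative.\<close>

lemma has_vector_derivative_exp_series:
  fixes T :: "'a::euclidean_space \<Rightarrow> 'a" and x :: 'a
  assumes T: "bounded_linear T"
  defines "e \<equiv> (\<lambda>t. \<Sum>k. (t ^ k / fact k) *\<^sub>R (T ^^ k) x)"
  shows "(e has_vector_derivative T (e t)) (at t)"
proof -
  have "((\<lambda>s. e s \<bullet> i) has_real_derivative T (e t) \<bullet> i) (at t)" for i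
  proof -
    define c where "c = (\<lambda>k. ((T ^^ k) x \<bullet> i) / fact k)"
    have bl: "bounded_linear (\<lambda>y. y \<bullet> i)"
      by (rule bounded_linear_inner_left)
    have sm: "summable (\<lambda>k. c k * s ^ k)" for s
      using bounded_linear.summable[OF bl summable_exp_series[OF T, of s x]]
      by (simp add: c_def field_simps)
    have "e s \<bullet> i = (\<Sum>k. c k * s ^ k)" for s
      unfolding e_def
      using bounded_linear.suminf[OF bl summable_exp_series[OF T, of s x]]
      by (simp add: c_def field_simps)
    moreover have "T (e t) \<bullet> i = (\<Sum>k. diffs c k * t ^ k)"
    proof -
      have "T (e t) \<bullet> i = (\<Sum>k. T ((t ^ k / fact k) *\<^sub>R (T ^^ k) x) \<bullet> i)"
        unfolding e_def
        using bounded_linear.suminf[OF bounded_linear_compose[OF bl T] summable_exp_series[OF T]]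
        by simp
      \<comment> \<open>The factor \<open>Suc k\<close> produced by \<open>diffs\<close> cancels
        against \<open>fact (Suc k)\<close>, leaving one more application of
        \<open>T\<close>.\<close>
      also have "\<dots> = (\<Sum>k. diffs c k * t ^ k)"
        by (intro suminf_cong)
          (simp add: c_def diffs_def linear_simps(5)[OF T] field_simps del: of_nat_Suc)
      finally show ?thesis .
    qed
    ultimately show ?thesis
      using termdiffs_strong_converges_everywhere[of c t] sm by simp
  qed
  then show ?thesis
    unfolding has_vector_derivative_def has_derivative_componentwise_within[of e]
    by (simp add: has_field_derivative_def mult.commute[of "T (e t) \<bullet> _"] mult_commute_abs)
qed

section \<open>Derivative of the determinant\<close>

text \<open>Row \<open>i\<close> of \<open>M ** X\<close> is a combination of the rows of
  \<open>X\<close>. By multilinearity only the multiple of row \<open>i\<close> itself survives,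
  since any other row would occur twice.\<close>

lemma det_replace_row:
  fixes M X :: "'a::comm_ring_1^'n^'n"
  shows "det (\<chi> j. if j = i then (M ** X) $ i else X $ j) = M $ i $ i * det X"
proof -
  have row: "(M ** X) $ i = (\<Sum>k\<in>UNIV. M $ i $ k *s X $ k)"
    by (simp add: vec_eq_iff matrix_matrix_mult_def)
  have rep: "det (\<chi> j. if j = i then X $ k else X $ j) = (if k = i then det X else 0)" for k
  proof (cases "k = i")
    case True
    have "(\<chi> j. if j = i then X $ k else X $ j) = X"
      using True by (simp add: vec_eq_iff)
    then show ?thesis using True by simp
  next
    case False
    then have "det (\<chi> j. if j = i then X $ k else X $ j) = 0"
      by (intro det_identical_rows[of i k]) (auto simp: row_def)
    with False show ?thesis by simp
  qed
  have "det (\<chi> j. if j = i then (M ** X) $ i else X $ j)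
      = (\<Sum>k\<in>UNIV. M $ i $ k * det (\<chi> j. if j = i then X $ k else X $ j))"
    unfolding row
    by (subst det_linear_row_sum) (simp_all add: det_row_mul[of i _ "\<lambda>_. X $ _"])
  also have "\<dots> = M $ i $ i * det X"
    unfolding rep by (simp add: if_distrib cong: if_cong)
  finally show ?thesis .
qed

text \<open>Liouville's formula. The product rule on the Leibniz expansion replaces one row at a
  time by a row of \<open>M ** X t\<close>, and \<open>det_replace_row\<close> evaluates the
  resulting determinants.\<close>

lemma has_vector_derivative_det:
  fixes X :: "real \<Rightarrow> complex^'n^'n"
  assumes "(X has_vector_derivative M ** X t) (at t)"
  shows "((\<lambda>s. det (X s)) has_vector_derivative trace M * det (X t)) (at t)"
proof -
  let ?U = "UNIV :: 'n set"
  let ?P = "{p. p permutes ?U}"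
  let ?D = "M ** X t"
  have entry: "((\<lambda>s. X s $ i $ j) has_derivative (\<lambda>h. h *\<^sub>R ?D $ i $ j)) (at t)" for i j
    using bounded_linear.has_vector_derivative[OF bounded_linear_vec_nth,
        OF bounded_linear.has_vector_derivative[OF bounded_linear_vec_nth assms]]
    by (simp add: has_vector_derivative_def)
  have "((\<lambda>s. det (X s)) has_derivative (\<lambda>h. \<Sum>p\<in>?P. of_int (sign p) *
      (\<Sum>i\<in>?U. h *\<^sub>R ?D $ i $ p i * (\<Prod>j\<in>?U - {i}. X t $ j $ p j)))) (at t)"
    unfolding det_def
    by (intro has_derivative_sum has_derivative_mult_right has_derivative_prod entry)
  moreover have "(\<Sum>p\<in>?P. of_int (sign p) *
      (\<Sum>i\<in>?U. h *\<^sub>R ?D $ i $ p i * (\<Prod>j\<in>?U - {i}. X t $ j $ p j)))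
      = h *\<^sub>R (trace M * det (X t))" for h
  proof -
    have "(\<Sum>p\<in>?P. of_int (sign p) *
        (\<Sum>i\<in>?U. h *\<^sub>R ?D $ i $ p i * (\<Prod>j\<in>?U - {i}. X t $ j $ p j)))
        = h *\<^sub>R (\<Sum>i\<in>?U. \<Sum>p\<in>?P. of_int (sign p) *
            (?D $ i $ p i * (\<Prod>j\<in>?U - {i}. X t $ j $ p j)))"
      by (subst sum.swap) (simp add: sum_distrib_left scaleR_sum_right)
    \<comment> \<open>After the exchange of sums, the inner sum for each \<open>i\<close> is the
      Leibniz expansion with row \<open>i\<close> replaced.\<close>
    also have "(\<Sum>i\<in>?U. \<Sum>p\<in>?P. of_int (sign p) *
            (?D $ i $ p i * (\<Prod>j\<in>?U - {i}. X t $ j $ p j)))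
        = (\<Sum>i\<in>?U. det (\<chi> j. if j = i then ?D $ i else X t $ j))"
    proof (rule sum.cong[OF refl])
      fix i
      have "(\<Prod>j\<in>?U. (\<chi> j. if j = i then ?D $ i else X t $ j) $ j $ p j)
          = ?D $ i $ p i * (\<Prod>j\<in>?U - {i}. X t $ j $ p j)" for p
        by (subst prod.remove[of _ i]) simp_all
      then show "(\<Sum>p\<in>?P. of_int (sign p) * (?D $ i $ p i * (\<Prod>j\<in>?U - {i}. X t $ j $ p j)))
          = det (\<chi> j. if j = i then ?D $ i else X t $ j)"
        by (simp add: det_def)
    qed
    also have "\<dots> = trace M * det (X t)"
      by (simp add: det_replace_row trace_def sum_distrib_right)
    finally show ?thesis .
  qed
  ultimately show ?thesis
    by (simp add: has_vector_derivative_def)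
qed

section \<open>Matrix exponential\<close>

text \<open>Boundedness is automatic in finite dimension; it supplies the product rule and lets
  multiplication pass through infinite sums.\<close>

lemma bounded_bilinear_matrix_mult:
  "bounded_bilinear ((**) :: complex^'n^'n \<Rightarrow> complex^'n^'n \<Rightarrow> complex^'n^'n)"
proof -
  have "bilinear ((**) :: complex^'n^'n \<Rightarrow> complex^'n^'n \<Rightarrow> complex^'n^'n)"
    unfolding bilinear_def
    by (auto intro!: linearI simp: mult_add_left matrix_add_ldistrib scaleR_mult_left)
      (simp add: vec_eq_iff matrix_matrix_mult_def scaleR_sum_right)
  then show ?thesis
    by (simp add: bilinear_conv_bounded_bilinear)
qed

text \<open>The adjoint is only conjugate-linear over the complex numbers, but time is real, so real
  linearity suffices for derivatives.\<close>

lemma bounded_linear_dagger: "bounded_linear (dagger :: complex^'n^'n \<Rightarrow> complex^'n^'n)"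
  by (rule linear_conv_bounded_linear[THEN iffD1])
    (auto intro!: linearI simp: dagger_add dagger_scaleR)

lemma bounded_linear_trace: "bounded_linear (trace :: complex^'n^'n \<Rightarrow> complex)"
  by (rule linear_conv_bounded_linear[THEN iffD1])
    (auto intro!: linearI simp: trace_add trace_scaleR_complex)

lemma bounded_linear_affine_fun: "bounded_linear (affine_fun a)"
  unfolding affine_fun_def[abs_def]
  by (rule bounded_linear_compose[OF bounded_linear_Re bounded_linear_compose
        [OF bounded_linear_trace bounded_bilinear.bounded_linear_left
          [OF bounded_bilinear_matrix_mult]]])

lemma matrix_mult_scaleR_right: "M ** (r *\<^sub>R N) = r *\<^sub>R (M ** N)" for M N :: "complex^'n^'n"
  by (rule bounded_bilinear.scaleR_right[OF bounded_bilinear_matrix_mult])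

lemma matrix_exp_scaleR:
  "matrix_exp (t *\<^sub>R M) = (\<Sum>k. (t ^ k / fact k) *\<^sub>R ((**) M ^^ k) (mat 1))"
proof -
  have "((**) (t *\<^sub>R M) ^^ k) (mat 1) = t ^ k *\<^sub>R ((**) M ^^ k) (mat 1)" for k
    by (induction k) (simp_all add: scaleR_mult_left matrix_mult_scaleR_right)
  then show ?thesis
    by (simp add: matrix_exp_def)
qed

lemma has_vector_derivative_matrix_exp:
  "((\<lambda>t. matrix_exp (t *\<^sub>R M)) has_vector_derivative M ** matrix_exp (t *\<^sub>R M)) (at t)"
  unfolding matrix_exp_scaleR
  by (rule has_vector_derivative_exp_series
      [OF bounded_bilinear.bounded_linear_right[OF bounded_bilinear_matrix_mult]])

lemma matrix_exp_0 [simp]: "matrix_exp (0 :: complex^'n^'n) = mat 1"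
proof -
  let ?M = "0 :: complex^'n^'n"
  \<comment> \<open>As \<open>0 ^ 0 = 1\<close>, exactly the term \<open>k = 0\<close>
    remains.\<close>
  have "(\<Sum>k. (0 ^ k / fact k) *\<^sub>R ((**) ?M ^^ k) (mat 1))
      = (\<Sum>k\<in>{0}. (0 ^ k / fact k) *\<^sub>R ((**) ?M ^^ k) (mat 1))"
    by (rule suminf_finite) simp_all
  then show ?thesis
    using matrix_exp_scaleR[of 0 ?M] by simp
qed

text \<open>Each term is a multiple of a power of \<open>M\<close>. This moves \<open>M\<close> to
  the right of the exponential, the side needed when differentiating inverses.\<close>

lemma matrix_exp_scaleR_commute: "matrix_exp (t *\<^sub>R M) ** M = M ** matrix_exp (t *\<^sub>R M)"
proof -
  let ?f = "\<lambda>k. (t ^ k / fact k) *\<^sub>R ((**) M ^^ k) (mat 1)"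
  have sm: "summable ?f"
    by (rule summable_exp_series
        [OF bounded_bilinear.bounded_linear_right[OF bounded_bilinear_matrix_mult]])
  have pow: "((**) M ^^ k) (mat 1) ** M = M ** ((**) M ^^ k) (mat 1)" for k
    by (induction k) (simp_all add: matrix_mul_assoc[symmetric])
  have "matrix_exp (t *\<^sub>R M) ** M = (\<Sum>k. ?f k ** M)"
    unfolding matrix_exp_scaleR
    by (rule bounded_linear.suminf[OF bounded_bilinear.bounded_linear_left
          [OF bounded_bilinear_matrix_mult] sm])
  also have "\<dots> = (\<Sum>k. M ** ?f k)"
    by (simp add: scaleR_mult_left matrix_mult_scaleR_right pow)
  also have "\<dots> = M ** matrix_exp (t *\<^sub>R M)"
    unfolding matrix_exp_scaleR
    by (rule bounded_linear.suminf[OF bounded_bilinear.bounded_linear_right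
          [OF bounded_bilinear_matrix_mult] sm, symmetric])
  finally show ?thesis .
qed

lemma has_vector_derivative_zero_imp_eq:
  fixes f :: "real \<Rightarrow> 'a::real_normed_vector"
  assumes "convex S" "\<And>x. x \<in> S \<Longrightarrow> (f has_vector_derivative 0) (at x within S)" "x \<in> S" "y \<in> S"
  shows "f x = f y"
proof -
  have "\<exists>c. \<forall>x\<in>S. f x = c"
    by (rule has_derivative_zero_constant) (use assms in \<open>auto simp: has_vector_derivative_def\<close>)
  with assms(3,4) show ?thesis by metis
qed

text \<open>Along \<open>t *\<^sub>R M\<close> the product has derivative zero, so its values at 1
  and 0 agree.\<close>

lemma matrix_exp_minus_mult: "matrix_exp (- M) ** matrix_exp M = mat 1"
proof -
  have "((\<lambda>t. matrix_exp (t *\<^sub>R (- M)) ** matrix_exp (t *\<^sub>R M)) has_vector_derivative 0) (at t)" for t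
  proof -
    have "matrix_exp (t *\<^sub>R (- M)) ** (M ** matrix_exp (t *\<^sub>R M))
        + (- M) ** matrix_exp (t *\<^sub>R (- M)) ** matrix_exp (t *\<^sub>R M) = 0"
      unfolding matrix_exp_scaleR_commute[of t "- M", symmetric]
      by (simp add: matrix_mul_assoc bounded_bilinear.minus_left[OF bounded_bilinear_matrix_mult]
          bounded_bilinear.minus_right[OF bounded_bilinear_matrix_mult] del: scaleR_minus_right)
    then show ?thesis
      using bounded_bilinear.has_vector_derivative[OF bounded_bilinear_matrix_mult
          has_vector_derivative_matrix_exp[of "- M" t] has_vector_derivative_matrix_exp[of M t]]
      by simp
  qed
  from has_vector_derivative_zero_imp_eq[OF convex_UNIV this, of 1 0] show ?thesis
    by simp
qed

text \<open>By Liouville's formula the determinant is constant along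
  \<open>t *\<^sub>R M\<close>.\<close>

lemma det_matrix_exp:
  assumes "trace M = 0"
  shows "det (matrix_exp M) = 1"
proof -
  have "((\<lambda>t. det (matrix_exp (t *\<^sub>R M))) has_vector_derivative 0) (at t)" for t
    using has_vector_derivative_det[OF has_vector_derivative_matrix_exp, of M t] assms by simp
  from has_vector_derivative_zero_imp_eq[OF convex_UNIV this, of 1 0] show ?thesis
    by simp
qed

section \<open>Positive semidefinite matrices\<close>

lemma matrix_vector_mult_axis: "M *v axis i 1 = column i M" for M :: "'a::semiring_1^'n^'m"
  by (simp add: vec_eq_iff matrix_vector_mult_def column_def axis_def if_distrib cong: if_cong)

lemma psd_diagonal_trace_nonneg:
  fixes P :: "complex^'n^'n"
  assumes "\<And>v. 0 \<le> Re (\<Sum>k\<in>UNIV. cnj (v $ k) * (P *v v) $ k)"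
  shows "0 \<le> Re (P $ i $ i)" and "0 \<le> Re (trace P)"
proof -
  show *: "0 \<le> Re (P $ i $ i)" for i
  proof -
    have "(\<Sum>k\<in>UNIV. cnj (axis i 1 $ k) * (P *v axis i 1) $ k) = P $ i $ i"
      unfolding matrix_vector_mult_axis
      by (simp add: column_def axis_def if_distrib[of cnj] if_distrib[of "\<lambda>z. z * y" for y]
          cong: if_cong)
    then show ?thesis
      using assms[of "axis i 1"] by simp
  qed
  then show "0 \<le> Re (trace P)"
    by (simp add: trace_def sum_nonneg)
qed

text \<open>Nonnegative diagonal entries with sum zero all vanish; a nonzero off-diagonal entry
  would then make the quadratic form negative somewhere.\<close>

lemma psd_trace_eq_0:
  fixes P :: "complex^'n^'n"
  assumes P: "P \<in> \<OO>" and psd: "\<And>v. 0 \<le> Re (\<Sum>k\<in>UNIV. cnj (v $ k) * (P *v v) $ k)"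
    and "Re (trace P) = 0"
  shows "P = 0"
proof -
  have sa: "cnj (P $ j $ i) = P $ i $ j" for i j
    using P by (simp add: selfadjoint_nth)
  have "Re (P $ i $ i) = 0" for i
    using assms(3) psd_diagonal_trace_nonneg(1)[OF psd]
    by (simp add: trace_def sum_nonneg_eq_0_iff)
  moreover have "Im (P $ i $ i) = 0" for i
    using sa[of i i] by (simp add: complex_eq_iff)
  ultimately have diag: "P $ i $ i = 0" for i
    by (simp add: complex_eq_iff)
  have "P $ i $ j = 0" for i j
  proof -
    \<comment> \<open>With zero diagonal the form at \<open>?v\<close> is
      \<open>cnj x * P $ i $ j + x * P $ j $ i\<close>; this choice of \<open>x\<close> makes both
      terms equal to minus the squared modulus of the entry.\<close>
    define x where "x = - P $ i $ j"
    let ?v = "x *s axis i 1 + axis j 1 :: complex^'n"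
    have "P *v ?v = x *s column i P + column j P"
      by (simp add: matrix_vector_right_distrib vector_scalar_commute matrix_vector_mult_axis)
    then have "(\<Sum>k\<in>UNIV. cnj (?v $ k) * (P *v ?v) $ k)
        = cnj x * (x * P $ i $ i + P $ i $ j) + (x * P $ j $ i + P $ j $ j)"
      by (simp add: column_def axis_def distrib_right sum.distrib if_distrib[of cnj]
          if_distrib[of "(*) y" for y] if_distrib[of "\<lambda>z. z * y" for y] cong: if_cong)
    also have "\<dots> = - 2 * of_real ((cmod (P $ i $ j))\<^sup>2)"
      unfolding complex_norm_square x_def
      using sa[of i j] diag by (simp add: mult.commute flip: sa[of j i])
    finally have "0 \<le> - 2 * (cmod (P $ i $ j))\<^sup>2"
      using psd[of ?v] by simp
    then show ?thesis by simp
  qed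
  then show ?thesis by (simp add: vec_eq_iff)
qed

lemma cinner_matrix_vector:
  "(\<Sum>i\<in>UNIV. cnj (v $ i) * (M *v w) $ i) = (\<Sum>i\<in>UNIV. cnj ((M\<^sup>\<dagger> *v v) $ i) * w $ i)"
proof -
  have "(\<Sum>i\<in>UNIV. cnj (v $ i) * (M *v w) $ i)
      = (\<Sum>i\<in>UNIV. \<Sum>j\<in>UNIV. cnj (v $ i) * M $ i $ j * w $ j)"
    by (simp add: matrix_vector_mult_def sum_distrib_left mult.assoc)
  also have "\<dots> = (\<Sum>j\<in>UNIV. \<Sum>i\<in>UNIV. cnj (v $ i) * M $ i $ j * w $ j)"
    by (rule sum.swap)
  also have "\<dots> = (\<Sum>i\<in>UNIV. cnj ((M\<^sup>\<dagger> *v v) $ i) * w $ i)"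
    by (simp add: matrix_vector_mult_def sum_distrib_left sum_distrib_right mult_ac)
  finally show ?thesis .
qed

lemma dagger_dagger [simp]: "(M\<^sup>\<dagger>)\<^sup>\<dagger> = M"
  by (simp add: vec_eq_iff)

lemma dagger_mat_1 [simp]: "(mat 1)\<^sup>\<dagger> = mat 1"
  by (auto simp: vec_eq_iff mat_def)

lemma conjugate_selfadjoint: "\<rho> \<in> \<OO> \<Longrightarrow> M ** \<rho> ** M\<^sup>\<dagger> \<in> \<OO>"
  by (simp add: selfadjoint_ops_def dagger_mult matrix_mul_assoc)

lemma conjugate_cancel:
  fixes M N X :: "complex^'n^'n"
  assumes "M ** N = mat 1"
  shows "M ** (N ** X ** N\<^sup>\<dagger>) ** M\<^sup>\<dagger> = X"
proof -
  have "M ** (N ** X ** N\<^sup>\<dagger>) ** M\<^sup>\<dagger> = (M ** N) ** X ** (M ** N)\<^sup>\<dagger>"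
    by (simp only: dagger_mult matrix_mul_assoc)
  then show ?thesis by (simp add: assms)
qed

text \<open>Conjugation preserves positivity. Trace zero would make the conjugate vanish, and
  undoing the conjugation would give \<open>\<rho> = 0\<close>, against trace one.\<close>

lemma trace_conjugate_pos:
  fixes \<rho> M N :: "complex^'n^'n"
  assumes "\<rho> \<in> \<S>" and inv: "N ** M = mat 1"
  shows "0 < Re (trace (M ** \<rho> ** M\<^sup>\<dagger>))"
proof -
  let ?P = "M ** \<rho> ** M\<^sup>\<dagger>"
  have \<rho>: "\<rho> \<in> \<OO>" "trace \<rho> = 1"
    and psd: "\<And>v. 0 \<le> Re (\<Sum>i\<in>UNIV. cnj (v $ i) * (\<rho> *v v) $ i)"
    using assms(1) by (auto simp: quantum_states_def trace_one_space_def)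
  have psdP: "0 \<le> Re (\<Sum>i\<in>UNIV. cnj (v $ i) * (?P *v v) $ i)" for v
    using psd[of "M\<^sup>\<dagger> *v v"]
    by (simp add: cinner_matrix_vector[of v M] flip: matrix_vector_mul_assoc)
  have "Re (trace ?P) \<noteq> 0"
  proof
    assume "Re (trace ?P) = 0"
    then have "?P = 0"
      by (rule psd_trace_eq_0[OF conjugate_selfadjoint[OF \<rho>(1)] psdP])
    then have "\<rho> = 0"
      using conjugate_cancel[OF inv, of \<rho>] by simp
    with \<rho>(2) show False by (simp add: trace_def)
  qed
  with psd_diagonal_trace_nonneg(2)[OF psdP] show ?thesis by simp
qed

section \<open>The vector field and its integral curves\<close>

text \<open>In \<open>L\<close> the self-adjoint part of \<open>B\<close> gives the Jordan product
  and the part \<open>- \<i> b\<close> the commutator. Commutators are traceless, so the trace comes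
  from \<open>a\<close> alone.\<close>

lemma vector_field_eq:
  assumes "a \<in> \<OO>" "b \<in> \<OO>" "\<xi> \<in> \<TT>\<^sub>1" and B: "B = (1/2) *\<^sub>R (a - \<i> \<cdot>\<^sub>C b)"
  defines "L \<equiv> B ** \<xi> + \<xi> ** B\<^sup>\<dagger>"
  shows "gradient_vf a \<xi> + hamiltonian_vf b \<xi> = L - Re (trace L) *\<^sub>R \<xi>"
    and "affine_fun a \<xi> = Re (trace L)"
proof -
  have L: "L = a \<odot> \<xi> + (\<i>/2) \<cdot>\<^sub>C (\<xi> ** b - b ** \<xi>)"
  proof -
    have Bd: "B\<^sup>\<dagger> = (1/2) *\<^sub>R (a + \<i> \<cdot>\<^sub>C b)"
      using assms(1,2) unfolding B
      by (simp add: dagger_scaleR dagger_diff dagger_cscale selfadjoint_ops_def)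
        (simp add: vec_eq_iff)
    show ?thesis
      unfolding L_def Bd unfolding B
      by (simp add: scaleR_mult_left matrix_mult_scaleR_right mult_diff_left matrix_add_ldistrib
          cscale_mult_left cscale_mult_right jordan_prod_def)
        (simp add: vec_eq_iff scaleR_conv_of_real[where 'a=complex] algebra_simps)
  qed
  show tr: "affine_fun a \<xi> = Re (trace L)"
    by (simp add: L jordan_prod_def trace_add trace_cscale trace_sub trace_mul_sym[of a]
        trace_mul_sym[of b] affine_fun_def)
  show "gradient_vf a \<xi> + hamiltonian_vf b \<xi> = L - Re (trace L) *\<^sub>R \<xi>"
    unfolding tr[symmetric]
    by (simp add: gradient_vf_eq(1)[OF assms(1,3)] hamiltonian_vf_eq(1)[OF assms(2,3)] L)
qed

lemma has_vector_derivative_conjugate: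
  fixes M X :: "real \<Rightarrow> complex^'n^'n"
  assumes "(M has_vector_derivative M') (at t)" "(X has_vector_derivative X') (at t)"
  shows "((\<lambda>s. M s ** X s ** (M s)\<^sup>\<dagger>) has_vector_derivative
    M' ** X t ** (M t)\<^sup>\<dagger> + M t ** X' ** (M t)\<^sup>\<dagger> + M t ** X t ** M'\<^sup>\<dagger>) (at t)"
  using bounded_bilinear.has_vector_derivative[OF bounded_bilinear_matrix_mult
      bounded_bilinear.has_vector_derivative[OF bounded_bilinear_matrix_mult assms]
      bounded_linear.has_vector_derivative[OF bounded_linear_dagger assms(1)]]
  by (simp add: mult_add_left add_ac)

text \<open>The generator is \<open>a - \<i> b\<close>, since by \<open>hamiltonian_vf_eq\<close>
  the sign \<open>a + \<i> b\<close> would reverse the commutator. The last conjunct is uniqueness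
  on every open interval around 0.\<close>

theorem proposition4:
  fixes a b \<rho> A :: "complex^'n^'n" and g \<gamma> :: "real \<Rightarrow> complex^'n^'n"
  assumes "a \<in> \<OO>" and "b \<in> \<OO>" and "trace a = 0" and "trace b = 0"
    and "\<rho> \<in> \<S>"
    and A: "A = a - \<i> \<cdot>\<^sub>C b"
    and g: "\<And>t. g t = matrix_exp ((t/2) *\<^sub>R A)"
    and \<gamma>: "\<And>t. \<gamma> t = (1 / trace (g t ** \<rho> ** (g t)\<^sup>\<dagger>)) \<cdot>\<^sub>C (g t ** \<rho> ** (g t)\<^sup>\<dagger>)"
  shows "A \<in> sl_alg \<and> (\<forall>t. g t \<in> SL_grp) \<and>
    integral_curve (\<lambda>\<xi>. gradient_vf a \<xi> + hamiltonian_vf b \<xi>) UNIV \<gamma> \<and> \<gamma> 0 = \<rho> \<and>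
    (\<forall>J \<eta>. 0 \<in> J \<and> \<eta> 0 = \<rho> \<and>
       integral_curve (\<lambda>\<xi>. gradient_vf a \<xi> + hamiltonian_vf b \<xi>) J \<eta> \<longrightarrow>
       (\<forall>t\<in>J. \<eta> t = \<gamma> t))"
proof -
  let ?V = "\<lambda>\<xi>. gradient_vf a \<xi> + hamiltonian_vf b \<xi>"
  define B where "B = (1/2) *\<^sub>R A"
  \<comment> \<open>The inverse of \<open>g\<close>, written as an exponential so that its
    derivative is known.\<close>
  define h where "h = (\<lambda>t. matrix_exp (t *\<^sub>R (- B)))"
  define P where "P = (\<lambda>t. g t ** \<rho> ** (g t)\<^sup>\<dagger>)"
  define \<tau> where "\<tau> = (\<lambda>t. Re (trace (P t)))"
  have \<rho>: "\<rho> \<in> \<OO>" "trace \<rho> = 1"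
    using \<open>\<rho> \<in> \<S>\<close> by (auto simp: quantum_states_def trace_one_space_def)
  have trA: "trace A = 0"
    using assms(3,4) by (simp add: A trace_sub trace_cscale)
  have gB: "g t = matrix_exp (t *\<^sub>R B)" for t
    by (simp add: g B_def)
  have g': "(g has_vector_derivative B ** g t) (at t)" for t
    using has_vector_derivative_matrix_exp[of B t] by (simp add: gB[abs_def])
  have h': "(h has_vector_derivative - (h t ** B)) (at t)" for t
    using has_vector_derivative_matrix_exp[of "- B" t] matrix_exp_scaleR_commute[of t "- B"]
    by (simp add: h_def bounded_bilinear.minus_right[OF bounded_bilinear_matrix_mult])
  have hg: "h t ** g t = mat 1" for t
    using matrix_exp_minus_mult[of "t *\<^sub>R B"] by (simp add: h_def gB)
  then have gh: "g t ** h t = mat 1" for t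
    by (simp add: matrix_left_right_inverse)
  have g0: "g 0 = mat 1" and h0: "h 0 = mat 1"
    by (simp_all add: g h_def)
  have B: "B = (1/2) *\<^sub>R (a - \<i> \<cdot>\<^sub>C b)"
    by (simp add: B_def A)

  have \<tau>_pos: "0 < \<tau> t" for t
    unfolding \<tau>_def P_def by (rule trace_conjugate_pos[OF \<open>\<rho> \<in> \<S>\<close> hg])
  have P_sa: "P t \<in> \<OO>" for t
    unfolding P_def by (rule conjugate_selfadjoint[OF \<rho>(1)])
  have trP: "trace (P t) = of_real (\<tau> t)" for t
  proof -
    have "cnj (trace (P t)) = trace (P t)"
      using P_sa[of t] by (simp add: selfadjoint_ops_def flip: trace_dagger)
    then show ?thesis
      by (simp add: \<tau>_def complex_eq_iff)
  qed
  \<comment> \<open>The trace is real, so the complex normalisation is a real scaling and the real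
    quotient rule applies.\<close>
  have \<gamma>P: "\<gamma> t = inverse (\<tau> t) *\<^sub>R P t" for t
  proof -
    have "\<gamma> t = (1 / of_real (\<tau> t)) \<cdot>\<^sub>C P t"
      unfolding \<gamma> trP[symmetric] P_def ..
    then show ?thesis
      by (simp add: vec_eq_iff scaleR_conv_of_real[where 'a=complex] divide_inverse)
  qed
  have \<gamma>T: "\<gamma> t \<in> \<TT>\<^sub>1" for t
    using P_sa[of t] \<tau>_pos[of t]
    by (simp add: \<gamma>P trace_one_space_def selfadjoint_ops_def dagger_scaleR trace_scaleR_complex trP
        scaleR_conv_of_real[where 'a=complex])
  have P': "(P has_vector_derivative B ** P t + P t ** B\<^sup>\<dagger>) (at t)" for t
    unfolding P_def
    using has_vector_derivative_conjugate[OF g'[of t] has_vector_derivative_const[of \<rho>]]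
    by (simp add: dagger_mult matrix_mul_assoc
        bounded_bilinear.zero_right[OF bounded_bilinear_matrix_mult]
        bounded_bilinear.zero_left[OF bounded_bilinear_matrix_mult])
  have \<tau>': "(\<tau> has_real_derivative Re (trace (B ** P t + P t ** B\<^sup>\<dagger>))) (at t)" for t
    unfolding \<tau>_def has_real_derivative_iff_has_vector_derivative
    by (intro bounded_linear.has_vector_derivative[OF bounded_linear_Re]
        bounded_linear.has_vector_derivative[OF bounded_linear_trace] P')
  have "(\<gamma> has_vector_derivative ?V (\<gamma> t)) (at t)" for t
  proof -
    let ?L = "B ** P t + P t ** B\<^sup>\<dagger>"
    have "((\<lambda>s. inverse (\<tau> s) *\<^sub>R P s) has_vector_derivative inverse (\<tau> t) *\<^sub>R ?L
        + (- (inverse (\<tau> t) * Re (trace ?L) * inverse (\<tau> t))) *\<^sub>R P t) (at t)"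
      using \<tau>_pos[of t] by (intro has_vector_derivative_scaleR DERIV_inverse' \<tau>' P') simp
    \<comment> \<open>By homogeneity the first term of the quotient rule is \<open>L\<close> at
      \<open>\<gamma> t\<close>; the second is
      \<open>- Re (trace L) *\<^sub>R \<gamma> t\<close>.\<close>
    moreover have "B ** \<gamma> t + \<gamma> t ** B\<^sup>\<dagger> = inverse (\<tau> t) *\<^sub>R ?L"
      by (simp add: \<gamma>P scaleR_mult_left matrix_mult_scaleR_right scaleR_right_distrib)
    ultimately show ?thesis
      unfolding vector_field_eq(1)[OF assms(1,2) \<gamma>T B]
      by (simp add: \<gamma>P[abs_def] trace_scaleR_complex mult_ac)
  qed
  then have curve: "integral_curve ?V UNIV \<gamma>"
    by (simp add: integral_curve_def \<gamma>T)

  have unique: "\<eta> t = \<gamma> t"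
    if J: "0 \<in> J" "t \<in> J" and \<eta>0: "\<eta> 0 = \<rho>" and \<eta>: "integral_curve ?V J \<eta>" for J \<eta> t
  proof -
    have conn: "connected J" and \<eta>T: "\<And>s. s \<in> J \<Longrightarrow> \<eta> s \<in> \<TT>\<^sub>1"
      and \<eta>': "\<And>s. s \<in> J \<Longrightarrow> (\<eta> has_vector_derivative ?V (\<eta> s)) (at s)"
      using \<eta> by (auto simp: integral_curve_def)
    define f where "f = (\<lambda>s. affine_fun a (\<eta> s))"
    define Q where "Q = (\<lambda>s. h s ** \<eta> s ** (h s)\<^sup>\<dagger>)"
    have Q': "(Q has_vector_derivative - (f s *\<^sub>R Q s)) (at s)" if "s \<in> J" for s
    proof -
      have V: "?V (\<eta> s) = B ** \<eta> s + \<eta> s ** B\<^sup>\<dagger> - f s *\<^sub>R \<eta> s"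
        unfolding f_def vector_field_eq(2)[OF assms(1,2) \<eta>T[OF that] B]
        by (rule vector_field_eq(1)[OF assms(1,2) \<eta>T[OF that] B])
      \<comment> \<open>The derivatives of \<open>h\<close> and its adjoint cancel the linear part
        of the field, leaving the scalar term.\<close>
      have "- (h s ** B) ** \<eta> s ** (h s)\<^sup>\<dagger> + h s ** ?V (\<eta> s) ** (h s)\<^sup>\<dagger>
          + h s ** \<eta> s ** (- (h s ** B))\<^sup>\<dagger> = - (f s *\<^sub>R Q s)"
      proof -
        have "(- (h s ** B))\<^sup>\<dagger> = - (B\<^sup>\<dagger> ** (h s)\<^sup>\<dagger>)"
          by (simp add: bounded_linear.linear[OF bounded_linear_dagger, THEN linear_neg] dagger_mult)
        then show ?thesis
          unfolding V Q_def
          by (simp add: mult_diff_left mult_diff_right mult_add_left matrix_add_ldistrib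
              matrix_mul_assoc scaleR_mult_left matrix_mult_scaleR_right
              bounded_bilinear.minus_left[OF bounded_bilinear_matrix_mult]
              bounded_bilinear.minus_right[OF bounded_bilinear_matrix_mult])
      qed
      then show ?thesis
        using has_vector_derivative_conjugate[OF h' \<eta>'[OF that]] by (simp add: Q_def)
    qed
    \<comment> \<open>The segment between 0 and \<open>t\<close> for either sign of
      \<open>t\<close>; it is compact, so the continuous \<open>f\<close> has an antiderivative
      \<open>G\<close> on it.\<close>
    let ?I = "{min 0 t..max 0 t}"
    have IJ: "?I \<subseteq> J"
      using connected_contains_Icc[OF conn] J by (simp add: min_def max_def)
    have "continuous_on ?I f"
    proof -
      have "continuous_on ?I \<eta>"
        by (intro continuous_at_imp_continuous_on ballI
            has_vector_derivative_continuous[OF \<eta>'] subsetD[OF IJ])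
      then show ?thesis
        unfolding f_def by (rule bounded_linear.continuous_on[OF bounded_linear_affine_fun])
    qed
    then obtain G where G: "\<And>s. s \<in> ?I \<Longrightarrow> (G has_vector_derivative f s) (at s within ?I)"
      using antiderivative_continuous by blast
    \<comment> \<open>The integrating factor contributes \<open>f s *\<^sub>R Q s\<close>, times
      \<open>exp (G s)\<close>, cancelling the same term from \<open>Q'\<close>.\<close>
    have "((\<lambda>s. exp (G s) *\<^sub>R Q s) has_vector_derivative 0) (at s within ?I)" if "s \<in> ?I" for s
    proof -
      have "((\<lambda>s. exp (G s)) has_real_derivative exp (G s) * f s) (at s within ?I)"
        by (rule DERIV_chain'[OF G[OF that, folded has_real_derivative_iff_has_vector_derivative]
              DERIV_exp])
      from has_vector_derivative_scaleR[OF this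
          has_vector_derivative_at_within[OF Q'[OF subsetD[OF IJ that]]]]
      show ?thesis by simp
    qed
    from has_vector_derivative_zero_imp_eq[OF _ this, of t 0]
    have "exp (G t) *\<^sub>R Q t = exp (G 0) *\<^sub>R \<rho>"
      by (simp add: Q_def h0 \<eta>0)
    then have "inverse (exp (G t)) *\<^sub>R (exp (G t) *\<^sub>R Q t)
        = (inverse (exp (G t)) * exp (G 0)) *\<^sub>R \<rho>"
      by (simp only: scaleR_scaleR)
    then have "Q t = (inverse (exp (G t)) * exp (G 0)) *\<^sub>R \<rho>"
      by simp
    then obtain c where c: "Q t = c *\<^sub>R \<rho>" ..
    have "\<eta> t = g t ** Q t ** (g t)\<^sup>\<dagger>"
      unfolding Q_def by (rule conjugate_cancel[OF gh, symmetric])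
    also have "\<dots> = c *\<^sub>R P t"
      by (simp add: c P_def scaleR_mult_left matrix_mult_scaleR_right)
    finally have \<eta>P: "\<eta> t = c *\<^sub>R P t" .
    have "of_real (c * \<tau> t) = (1 :: complex)"
      using \<eta>T[OF J(2)]
      by (simp add: \<eta>P trace_one_space_def trace_scaleR_complex trP
          scaleR_conv_of_real[where 'a=complex])
    then have "c * \<tau> t = 1"
      by (simp only: of_real_eq_1_iff)
    then have "c = inverse (\<tau> t)"
      using \<tau>_pos[of t] by (simp add: field_simps)
    then show ?thesis
      by (simp add: \<eta>P \<gamma>P)
  qed
  have "\<gamma> 0 = \<rho>"
    by (simp add: \<gamma> g0 \<rho>(2)) (simp add: vec_eq_iff)
  moreover have "g t \<in> SL_grp" for t
    using det_matrix_exp[of "(t/2) *\<^sub>R A"] by (simp add: SL_grp_def g trace_scaleR_complex trA)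
  moreover have "A \<in> sl_alg"
    using trA by (simp add: sl_alg_def)
  ultimately show ?thesis
    by (intro conjI allI impI ballI curve) (auto intro: unique)
qed

end
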